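(* Let $\gamma,\eta,\omega,\lambda\in\mathbb{R}$, $a\in\mathbb{C}$, $k\in\mathbb{Z}$, $m\in\mathbb{N}$ and $n\in\mathbb{N}_0$. Then the generalized Apostol-Bernoulli poly-Daehee polynomials satisfy $${}_{\mathfrak{B}}\mathfrak{D}_{n,a}^{[k,m-1]}(\gamma+\omega,\eta;\lambda)=\sum_{j=0}^{n}\binom{n}{j}\,{}_{\mathfrak{B}}\mathfrak{D}_{n-j,a}^{[k,m-1]}(\gamma,\eta;\lambda)\,(\omega)_j,$$ where $(\omega)_j=\omega(\omega-1)(\omega-2)\cdots(\omega-j+1)$ (with $(\omega)_0=1$).
   Context: $\mathbb{N}=\{1,2,\dots\}$, $\mathbb{N}_0=\mathbb{N}\cup\{0\}$. The polylogarithm is $\mathrm{Li}_k(z)=\sum_{r=1}^{\infty} z^r/r^k$. Generalized Apostol-Bernoulli poly-Daehee polynomials (GABPDP), defined by the generating function $$(1+x)^{\gamma}\,\frac{\log(1+x)}{\mathrm{Li}_k(1-e^{-x})}\,e^{\eta x}\left(\frac{x^m}{\lambda e^x-\sum_{l=0}^{m-1}\frac{x^l}{l!}}\right)^{a}=\sum_{n=0}^\infty {}_{\mathfrak{B}}\mathfrak{D}_{n,a}^{[k,m-1]}(\gamma,\eta;\lambda)\frac{x^n}{n!}.$$ *)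

theory Defs
  imports "HOL-Analysis.Analysis"
begin

text \<open>
  All generating functions are formal power series in the variable \<open>x\<close> (written \<open>fps_X\<close>)
  over the complex numbers.  In the library, \<open>fps_ln 1\<close> is \<open>log (1 + x)\<close>, \<open>fps_binomial c\<close> is
  \<open>(1 + x)\<close> to the power \<open>c\<close>, \<open>fps_exp c\<close> is \<open>e\<close> to the power \<open>c x\<close>, and \<open>f oo g\<close> is composition.
\<close>

definition fps_polylog :: "int \<Rightarrow> complex fps" where
  "fps_polylog k = Abs_fps (\<lambda>r. if r = 0 then 0 else 1 / (of_nat r powi k))"

text \<open>
  The power \<open>f\<^sup>a\<close> for complex \<open>a\<close>.  Write \<open>f = c x\<^sup>s (1 + h)\<close> with \<open>c \<noteq> 0\<close> and \<open>h\<close> of zero constant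
  term; then \<open>f\<^sup>a = c\<^sup>a x\<^sup>s\<^sup>a (1 + h)\<^sup>a\<close>, with the principal value of \<open>c\<^sup>a\<close> and the binomial series for
  \<open>(1 + h)\<^sup>a\<close>.  This is a power series in \<open>x\<close> exactly if \<open>s a\<close> is a natural number; otherwise
  the (nonexistent) power is given the value 0.  For the Apostol factor below, \<open>s = 0\<close> if
  \<open>\<lambda> = 1\<close> (every complex \<open>a\<close> is then admissible) and \<open>s = m\<close> otherwise.
\<close>

definition fps_cpow :: "complex fps \<Rightarrow> complex \<Rightarrow> complex fps" where
  "fps_cpow f a =
     (if \<exists>N::nat. of_nat (subdegree f) * a = of_nat N
      then (let c = fps_nth f (subdegree f);
                N = (THE N::nat. of_nat (subdegree f) * a = of_nat N)
            in fps_const (c powr a) * fps_X ^ N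
                 * (fps_binomial a oo (fps_const (1 / c) * fps_shift (subdegree f) f - 1)))
      else 0)"

lemma fps_cpow_eq:
  assumes "of_nat (subdegree f) * a = of_nat N"
  shows "fps_cpow f a = fps_const (fps_nth f (subdegree f) powr a) * fps_X ^ N
           * (fps_binomial a oo
               (fps_const (1 / fps_nth f (subdegree f)) * fps_shift (subdegree f) f - 1))"
proof -
  have "(THE N::nat. of_nat (subdegree f) * a = of_nat N) = N"
    unfolding assms by (rule the_equality) simp_all
  moreover have "\<exists>N::nat. of_nat (subdegree f) * a = of_nat N"
    using assms by blast
  ultimately show ?thesis
    by (simp only: fps_cpow_def Let_def if_True)
qed

lemma fps_cpow_of_nat:
  assumes "f \<noteq> 0"
  shows "fps_cpow f (of_nat n) = f ^ n"
proof -
  define s where "s = subdegree f"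
  define c where "c = fps_nth f s"
  define g where "g = fps_shift s f"
  have c: "c \<noteq> 0"
    using assms by (simp add: c_def s_def)
  have f: "f = g * fps_X ^ s"
    unfolding g_def s_def by (rule subdegree_decompose)
  have h0: "fps_nth (fps_const (1 / c) * g - 1) 0 = 0"
    using c by (simp add: g_def c_def)
  have "fps_binomial (of_nat n) oo (fps_const (1 / c) * g - 1)
          = (1 + fps_X) ^ n oo (fps_const (1 / c) * g - 1)"
    by (simp add: fps_binomial_of_nat)
  also have "\<dots> = ((1 + fps_X) oo (fps_const (1 / c) * g - 1)) ^ n"
    by (rule fps_compose_power[OF h0, symmetric])
  also have "\<dots> = (fps_const (1 / c) * g) ^ n"
    using h0 by (simp add: fps_compose_add_distrib)
  finally have b: "fps_binomial (of_nat n) oo (fps_const (1 / c) * g - 1)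
                     = (fps_const (1 / c) * g) ^ n" .
  have "fps_cpow f (of_nat n)
          = fps_const (c ^ n) * fps_X ^ (s * n) * (fps_const (1 / c) * g) ^ n"
    using fps_cpow_eq[of f "of_nat n" "s * n"] b c
    by (simp add: s_def c_def g_def powr_nat)
  also have "\<dots> = (fps_const c * fps_const (1 / c) * g * fps_X ^ s) ^ n"
    by (simp add: power_mult_distrib power_mult fps_const_power [symmetric]
             del: fps_const_power fps_const_mult)
  also have "fps_const c * fps_const (1 / c) = 1"
    using c by simp
  finally show ?thesis
    using f by simp
qed

definition apostol_denom :: "nat \<Rightarrow> real \<Rightarrow> complex fps" where
  "apostol_denom m lam =
     fps_const (of_real lam) * fps_exp 1 - (\<Sum>l<m. fps_const (1 / fact l) * fps_X ^ l)"

definition GABPDP_gf ::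
  "int \<Rightarrow> nat \<Rightarrow> complex \<Rightarrow> real \<Rightarrow> real \<Rightarrow> real \<Rightarrow> complex fps" where
  "GABPDP_gf k m a \<gamma> \<eta> lam =
     fps_binomial (of_real \<gamma>) * (fps_ln 1 / (fps_polylog k oo (1 - fps_exp (-1))))
       * fps_exp (of_real \<eta>) * fps_cpow (fps_X ^ m / apostol_denom m lam) a"

text \<open>
  The parameter \<open>lam\<close> is \<open>\<lambda>\<close>, which is reserved syntax.  The second parameter of \<open>GABPDP\<close> is \<open>m\<close> (the superscript in the usual notation
  is \<open>[k, m - 1]\<close>); the definition is meant for \<open>m \<ge> 1\<close>.
\<close>

definition GABPDP ::
  "int \<Rightarrow> nat \<Rightarrow> complex \<Rightarrow> nat \<Rightarrow> real \<Rightarrow> real \<Rightarrow> real \<Rightarrow> complex" where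
  "GABPDP k m a n \<gamma> \<eta> lam = fact n * fps_nth (GABPDP_gf k m a \<gamma> \<eta> lam) n"

lemma GABPDP_generating_function:
  "Abs_fps (\<lambda>n. GABPDP k m a n \<gamma> \<eta> lam / fact n) = GABPDP_gf k m a \<gamma> \<eta> lam"
  by (simp add: GABPDP_def fps_eq_iff)

text \<open>
  Both quotients above are exact, i.e. multiplying by the denominator gives back the
  numerator; truncated division of power series never occurs.
\<close>

lemma polylog_quotient_exact:
  "fps_ln 1 / (fps_polylog k oo (1 - fps_exp (-1))) * (fps_polylog k oo (1 - fps_exp (-1)))
     = fps_ln (1::complex)"
proof -
  let ?P = "fps_polylog k oo (1 - fps_exp (-1))"
  have P1: "fps_nth ?P 1 \<noteq> 0"
    by (simp add: fps_compose_nth fps_polylog_def)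
  then have "?P \<noteq> 0"
    by force
  moreover have "subdegree ?P \<le> 1"
    using P1 by (rule subdegree_leI)
  moreover have "1 \<le> subdegree (fps_ln (1::complex))"
    by (rule subdegree_geI) (auto simp: fps_ln_def fps_eq_iff intro!: exI[of _ 1])
  ultimately have "?P dvd fps_ln 1"
    by (subst fps_dvd_iff) auto
  then show ?thesis
    by (rule dvd_div_mult_self)
qed

lemma apostol_quotient_exact:
  assumes "m \<ge> 1"
  shows "fps_X ^ m / apostol_denom m lam * apostol_denom m lam = fps_X ^ m"
proof -
  let ?D = "apostol_denom m lam"
  have nth: "fps_nth ?D n = of_real lam / fact n - (if n < m then 1 / fact n else 0)" for n
    by (simp add: apostol_denom_def fps_sum_nth if_distrib sum.delta cong: if_cong)
  obtain i where i: "i \<le> m" "fps_nth ?D i \<noteq> 0"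
  proof (cases "lam = 1")
    case True
    then have "fps_nth ?D m \<noteq> 0"
      unfolding nth by simp
    then show ?thesis
      using that by blast
  next
    case False
    then have "complex_of_real lam \<noteq> 1"
      by (metis of_real_1 of_real_eq_iff)
    then have "fps_nth ?D 0 \<noteq> 0"
      unfolding nth using assms by simp
    then show ?thesis
      using that by blast
  qed
  have "?D \<noteq> 0"
    using i(2) by force
  moreover have "subdegree ?D \<le> m"
    using subdegree_leI[OF i(2)] i(1) by (rule le_trans)
  ultimately have "?D dvd fps_X ^ m"
    by (subst fps_dvd_iff) simp_all
  then show ?thesis
    by (rule dvd_div_mult_self)
qed

definition falling_fact :: "real \<Rightarrow> nat \<Rightarrow> real" where
  "falling_fact w j = (\<Prod>i<j. w - real i)"

end

theory Submission
  imports Defs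
begin

text \<open>The parameter \<open>\<gamma>\<close> enters the generating function only through the
  factor \<open>(1 + x)\<close> to the power \<open>\<gamma>\<close>, so a shift by
  \<open>\<omega>\<close> multiplies the whole series by the binomial series of
  \<open>\<omega>\<close> (\<open>GABPDP_gf_add\<close>). That series is the exponential generating
  function of the falling factorials (\<open>of_real_falling_fact\<close>), and the claim is the
  resulting binomial convolution.\<close>

lemma of_real_falling_fact:
  "of_real (falling_fact w j) = fact j * (of_real w gchoose j :: complex)"
  by (simp add: falling_fact_def gbinomial_prod_rev atLeast0LessThan)

lemma GABPDP_gf_add:
  "GABPDP_gf k m a (\<gamma> + \<omega>) \<eta> lam = fps_binomial (of_real \<omega>) * GABPDP_gf k m a \<gamma> \<eta> lam"
  by (simp add: GABPDP_gf_def fps_binomial_add_mult mult_ac)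

theorem theorem2p3:
  fixes \<gamma> \<eta> \<omega> lam :: real and a :: complex and k :: int and m n :: nat
  assumes "m \<ge> 1"
  shows "GABPDP k m a n (\<gamma> + \<omega>) \<eta> lam
       = (\<Sum>j=0..n. of_nat (n choose j) * GABPDP k m a (n - j) \<gamma> \<eta> lam
                      * of_real (falling_fact \<omega> j))"
proof -
  let ?G = "GABPDP_gf k m a \<gamma> \<eta> lam"
  \<comment> \<open>Coefficient \<open>n\<close> of the Cauchy product, with \<open>j\<close>
    indexing the binomial series.\<close>
  have "GABPDP k m a n (\<gamma> + \<omega>) \<eta> lam
      = (\<Sum>j=0..n. fact n * ((of_real \<omega> gchoose j) * fps_nth ?G (n - j)))"
    by (simp add: GABPDP_def GABPDP_gf_add fps_mult_nth sum_distrib_left)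
  also have "\<dots> = (\<Sum>j=0..n. of_nat (n choose j) * GABPDP k m a (n - j) \<gamma> \<eta> lam
                      * of_real (falling_fact \<omega> j))"
    \<comment> \<open>Termwise, as \<open>j \<le> n\<close>:
      \<open>fact n = of_nat (n choose j) * fact (n - j) * fact j\<close>, where
      \<open>fact (n - j)\<close> normalises the coefficient of \<open>?G\<close> and
      \<open>fact j\<close> turns \<open>gchoose\<close> into a falling factorial.\<close>
    by (intro sum.cong refl)
      (simp add: GABPDP_def of_real_falling_fact binomial_fact)
  finally show ?thesis .
qed

end
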